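(* Let $C_1=(v_1,h_1),\ C_2=(v_2,h_2)\in F$ and let $t=t(C_1,C_2)=[p_1,p_2,p_3,p_4]\in L^4$ be the corresponding quadruple. The following are equivalent: \begin{itemize} \item $(F,+,* )$ is a presemifield, where $x*y=T\big((C_1y^{\sigma}+C_2\overline{y}^{\sigma})x\big)+T(xy)z$; \item $T(C_1x\overline{x}^{\sigma}+C_2x^{\sigma+1})\neq 0$ for all $0\neq x\in F$; \item the polynomial $P_{C_1,C_2,s}(X)=C_2X^{\sigma+1}+\overline{C_1}X^{\sigma}+C_1X+\overline{C_2}\in F[X]$ has no root of norm $1$, i.e. no root $X\in F$ with $N(X)=1$; \item the polynomial $p_{s,t}(X)=p_1X^{\sigma+1}+p_2X^{\sigma}+p_3X+p_4\in L[X]$ has no root in $L$. \end{itemize}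
   Context: Let $m\ge 1$, $F=GF(2^{2m})\supset L=GF(2^m)$, $\overline{x}=x^{2^m}$ for $x\in F$, and let $T(x)=x+\overline{x}$, $N(x)=x\overline{x}$ be the trace and norm from $F$ to $L$. Fix $\mu\in L$ of absolute trace $1$ and $z\in F$ with $z^2+z=\mu$; then $1,z$ is a basis of $F$ over $L$ and we write $(a,b)=a+bz$ for $a,b\in L$. Let $0\le s<2m$ be an integer and $\sigma=2^s$, so $x^{\sigma}=x^{2^s}$. Put $\mu_s=\sum_{i=0}^{s-1}\mu^{2^i}$ (so $\mu_0=0$). For $C_1=(v_1,h_1)$, $C_2=(v_2,h_2)\in F$ the corresponding quadruple $t=t(C_1,C_2)=[p_1,p_2,p_3,p_4]\in L^4$ is given by $p_1=h_1+h_2$, $p_2=v_1+v_2+h_1+h_2$, $p_3=v_1+v_2+\mu_sh_1+(\mu_s+1)h_2$, $p_4=\mu_sv_1+(\mu_s+1)v_2+(\mu_s+\mu)h_1+(\mu_s+\mu+1)h_2$. A (finite) presemifield is a finite additive abelian group with a multiplication that is distributive on both sides over addition and has no zero divisors ($x*y=0$ implies $x=0$ or $y=0$).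
   Formalization: The fourth item is stated as "p_1 ≠ 0 and p_{s,t} has no root in L". Without p_1 ≠ 0 the equivalence fails: for C_1 = C_2 = v in L, v ≠ 0, the polynomial p_{s,t} is the nonzero constant v, yet P_{C_1,C_2,s} has the norm-1 root X = 1. *)

theory Defs
  imports "HOL-Computational_Algebra.Polynomial"
begin

(* F is a finite field type of cardinality 2^(2m); its subfield L of order 2^m is the set of
   fixed points of x |-> x^(2^m). *)

definition subfield_L :: "nat \<Rightarrow> 'a::{field,finite} set" where
  "subfield_L m = {x. x ^ (2 ^ m) = x}"

definition bar :: "nat \<Rightarrow> 'a::{field,finite} \<Rightarrow> 'a" where
  "bar m x = x ^ (2 ^ m)"

definition rel_trace :: "nat \<Rightarrow> 'a::{field,finite} \<Rightarrow> 'a" where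
  "rel_trace m x = x + bar m x"

definition rel_norm :: "nat \<Rightarrow> 'a::{field,finite} \<Rightarrow> 'a" where
  "rel_norm m x = x * bar m x"

(* Trace from L = GF(2^m) to GF(2), for arguments in L. *)
definition abs_trace :: "nat \<Rightarrow> 'a::{field,finite} \<Rightarrow> 'a" where
  "abs_trace m x = (\<Sum>i<m. x ^ (2 ^ i))"

definition mu_sum :: "'a::{field,finite} \<Rightarrow> nat \<Rightarrow> 'a" where
  "mu_sum \<mu> s = (\<Sum>i<s. \<mu> ^ (2 ^ i))"

definition elem_of_coords :: "'a::{field,finite} \<Rightarrow> 'a \<times> 'a \<Rightarrow> 'a" where
  "elem_of_coords z c = fst c + snd c * z"

(* The additive group is that of the type. *)
definition presemifield :: "('a::{ab_group_add,finite} \<Rightarrow> 'a \<Rightarrow> 'a) \<Rightarrow> bool" where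
  "presemifield f \<longleftrightarrow>
     (\<forall>x y w. f x (y + w) = f x y + f x w) \<and>
     (\<forall>x y w. f (x + y) w = f x w + f y w) \<and>
     (\<forall>x y. f x y = 0 \<longrightarrow> x = 0 \<or> y = 0)"

definition star ::
  "nat \<Rightarrow> 'a::{field,finite} \<Rightarrow> nat \<Rightarrow> 'a \<Rightarrow> 'a \<Rightarrow> 'a \<Rightarrow> 'a \<Rightarrow> 'a" where
  "star m z s C1 C2 x y =
     rel_trace m ((C1 * y ^ (2 ^ s) + C2 * (bar m y) ^ (2 ^ s)) * x) + rel_trace m (x * y) * z"

definition norm_poly ::
  "nat \<Rightarrow> nat \<Rightarrow> 'a::{field,finite} \<Rightarrow> 'a \<Rightarrow> 'a poly" where
  "norm_poly m s C1 C2 =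
     monom C2 (2 ^ s + 1) + monom (bar m C1) (2 ^ s) + monom C1 1 + monom (bar m C2) 0"

definition quadruple ::
  "'a::{field,finite} \<Rightarrow> nat \<Rightarrow> 'a \<times> 'a \<Rightarrow> 'a \<times> 'a \<Rightarrow> 'a \<times> 'a \<times> 'a \<times> 'a" where
  "quadruple \<mu> s = (\<lambda>(v1, h1) (v2, h2).
     (h1 + h2,
      v1 + v2 + h1 + h2,
      v1 + v2 + mu_sum \<mu> s * h1 + (mu_sum \<mu> s + 1) * h2,
      mu_sum \<mu> s * v1 + (mu_sum \<mu> s + 1) * v2
        + (mu_sum \<mu> s + \<mu>) * h1 + (mu_sum \<mu> s + \<mu> + 1) * h2))"

(* For a quadruple in L^4 this is the polynomial of L[X], viewed in F[X].  It is meant as a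
   projective polynomial of formal degree 2^s + 1: if p1 = 0 it has a root at infinity, so
   "no root" requires p1 \<noteq> 0.  Without that, C1 = C2 = v for a nonzero v in L would give the
   nonzero constant v, which has no root in L, although norm_poly has the root 1. *)
definition quad_poly :: "nat \<Rightarrow> 'a \<times> 'a \<times> 'a \<times> 'a \<Rightarrow> 'a::{field,finite} poly" where
  "quad_poly s = (\<lambda>(p1, p2, p3, p4).
     monom p1 (2 ^ s + 1) + monom p2 (2 ^ s) + monom p3 1 + monom p4 0)"

end

theory Submission
  imports Defs "HOL-Number_Theory.Residues"
begin

text \<open>
  Put \<open>q = 2 ^ s\<close> and \<open>G x = T (C1 x (bar x) ^ q + C2 x ^ (q + 1))\<close>; then \<open>G (c x) = c ^ (q + 1) G x\<close>
  for \<open>c \<in> L\<close>, so the zeros of \<open>G\<close> are a set of points of the projective line \<open>F* / L*\<close>.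
  If \<open>x * y = 0\<close> with \<open>x, y \<noteq> 0\<close>, then \<open>T (x y) = 0\<close> forces \<open>y = c (bar x)\<close> with \<open>c \<in> L\<close>,
  and what remains is \<open>c ^ q G x = 0\<close>.
  Dividing \<open>G x\<close> by \<open>(bar x) ^ (q + 1)\<close> gives the value of the norm polynomial at \<open>x / bar x\<close>,
  and by Hilbert 90 these quotients are all the elements of norm 1.
  Finally, the points of the projective line are represented by \<open>1\<close> and by \<open>a + z\<close> with
  \<open>a \<in> L\<close>; there \<open>G\<close> takes the values \<open>p1\<close> and \<open>p(a)\<close>, respectively.
\<close>

text \<open>
  \<open>finite_field_power_card_eq_same\<close> is stated for the class \<open>finite_field\<close>, which the sort
  \<open>{field, finite}\<close> does not entail.
\<close>

lemma finite_field_power_card: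
  fixes x :: "'a::{field,finite}"
  shows "x ^ card (UNIV :: 'a set) = x"
proof (cases "x = 0")
  case True
  then show ?thesis
    by (simp add: finite_UNIV_card_ge_0)
next
  case False
  let ?U = "UNIV - {0 :: 'a}"
  have "bij_betw ((*) x) ?U ?U"
    by (rule bij_betwI[where g = "\<lambda>y. y / x"]) (use False in auto)
  then have "\<Prod>?U = (\<Prod>y\<in>?U. x * y)"
    using prod.reindex_bij_betw[of "(*) x" ?U ?U "\<lambda>y. y"] by simp
  also have "\<dots> = x ^ card ?U * \<Prod>?U"
    by (simp add: prod.distrib)
  finally have "x ^ card ?U = 1"
    by simp
  moreover have "card (UNIV :: 'a set) = Suc (card ?U)"
    by (metis UNIV_I card.remove finite)
  ultimately show ?thesis
    by (simp only: power_Suc mult_1_right)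
qed

locale quadratic_gf =
  fixes m :: nat and \<mu> z :: "'a::{field,finite}"
  assumes card_UNIV: "card (UNIV :: 'a set) = 2 ^ (2 * m)"
    and trace_mu: "abs_trace m \<mu> = 1"
    and z_root: "z ^ 2 + z = \<mu>"
begin

section \<open>Arithmetic in characteristic 2\<close>

lemma CHAR_2: "CHAR('a) = 2"
proof -
  have "prime CHAR('a)"
    by (rule prime_CHAR_semidom) (simp add: finite_imp_CHAR_pos)
  moreover have "CHAR('a) dvd 2 ^ (2 * m)"
    using CHAR_dvd_CARD[where 'a = 'a] card_UNIV by simp
  ultimately show ?thesis
    by (metis prime_dvd_power primes_dvd_imp_eq two_is_prime_nat)
qed

lemma minus_eq_plus: "x - y = x + (y :: 'a)"
  by (rule minus_CHAR_2[OF CHAR_2])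

lemma add_self: "x + x = (0 :: 'a)"
  by (metis minus_eq_plus diff_self)

lemma add_self_left: "x + (x + y) = (y :: 'a)"
  by (simp add: add_self flip: add.assoc)

lemma add_eq_0_iff_eq: "x + y = 0 \<longleftrightarrow> x = (y :: 'a)"
  by (metis minus_eq_plus eq_iff_diff_eq_0)

text \<open>\<open>algebra_simps\<close> sorts sums into right-nested form, so equal summands become
  adjacent; \<open>add_self_left\<close> cancels such pairs inside a sum, \<open>add_self\<close> at
  its end.\<close>

lemmas char_2_simps = add_self add_self_left algebra_simps

lemma add_power_2_power: "(x + y :: 'a) ^ (2 ^ n) = x ^ (2 ^ n) + y ^ (2 ^ n)"
  by (rule freshmans_dream') (simp_all add: CHAR_2)

text \<open>Iterating \<open>z ^ 2 = z + \<mu>\<close>. This is where the constants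
  \<open>mu_sum \<mu> s\<close> of the quadruple come from.\<close>

lemma z_power_2_power: "z ^ (2 ^ n) = z + mu_sum \<mu> n"
proof (induction n)
  case 0
  show ?case by (simp add: mu_sum_def)
next
  case (Suc n)
  have "z ^ 2 = z + \<mu>"
    using z_root by (metis add_self_left add.commute)
  then have "z ^ (2 ^ Suc n) = z ^ (2 ^ n) + \<mu> ^ (2 ^ n)"
    by (simp add: power_mult add_power_2_power)
  with Suc show ?case
    by (simp add: mu_sum_def add.assoc)
qed

section \<open>Conjugation, trace and coordinates over \<open>L\<close>\<close>

lemma bar_add: "bar m (x + y) = bar m x + bar m (y :: 'a)"
  by (simp add: bar_def add_power_2_power)

lemma bar_mult: "bar m (x * y) = bar m x * bar m (y :: 'a)"
  by (simp add: bar_def power_mult_distrib)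

lemma bar_power: "bar m (x ^ n) = bar m (x :: 'a) ^ n"
  by (simp add: bar_def mult.commute flip: power_mult)

lemma bar_divide: "bar m (x / y) = bar m x / bar m (y :: 'a)"
  by (simp add: bar_def power_divide)

lemma bar_bar: "bar m (bar m x) = (x :: 'a)"
proof -
  have "bar m (bar m x) = x ^ card (UNIV :: 'a set)"
    by (simp add: bar_def card_UNIV mult_2 flip: power_mult power_add)
  then show ?thesis
    by (simp add: finite_field_power_card)
qed

lemma bar_0: "bar m 0 = (0 :: 'a)" and bar_1: "bar m 1 = (1 :: 'a)"
  by (simp_all add: bar_def)

lemma bar_eq_0_iff: "bar m x = 0 \<longleftrightarrow> x = (0 :: 'a)"
  by (simp add: bar_def)

text \<open>For \<open>n = m\<close> the shift \<open>mu_sum \<mu> n\<close> is the absolute trace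
  of \<open>\<mu>\<close>.\<close>

lemma bar_z: "bar m z = z + 1"
  using trace_mu by (simp add: bar_def z_power_2_power mu_sum_def abs_trace_def)

lemmas bar_simps = bar_add bar_mult bar_power bar_divide bar_bar bar_0 bar_1 bar_eq_0_iff bar_z

lemma in_L_iff: "x \<in> subfield_L m \<longleftrightarrow> bar m x = (x :: 'a)"
  by (simp add: subfield_L_def bar_def)

lemma trace_in_L: "bar m (rel_trace m x) = rel_trace m (x :: 'a)"
  by (simp add: rel_trace_def bar_simps add.commute)

lemma trace_add: "rel_trace m (x + y) = rel_trace m x + rel_trace m (y :: 'a)"
  by (simp add: rel_trace_def bar_simps algebra_simps)

lemma trace_scale: "bar m c = c \<Longrightarrow> rel_trace m (c * x) = c * rel_trace m (x :: 'a)"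
  by (simp add: rel_trace_def bar_simps algebra_simps)

lemma trace_eq_0_iff: "rel_trace m x = 0 \<longleftrightarrow> bar m x = (x :: 'a)"
  by (auto simp: rel_trace_def add_eq_0_iff_eq)

text \<open>Since \<open>bar m z = z + 1\<close>, the trace is \<open>L\<close>-linear with
  \<open>T(1) = 0\<close> and \<open>T(z) = 1\<close>: it is the
  \<open>z\<close>-coordinate.\<close>

lemma trace_coords:
  assumes "bar m a = a" "bar m b = b"
  shows "rel_trace m (a + b * z) = b"
  using assms by (simp add: rel_trace_def bar_simps char_2_simps)

lemma coords_eq_0_iff:
  assumes "bar m a = a" "bar m b = b"
  shows "a + b * z = 0 \<longleftrightarrow> a = 0 \<and> b = 0"
proof
  assume *: "a + b * z = 0"
  then have "b = 0"
    using trace_coords[OF assms] by (metis trace_eq_0_iff bar_0)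
  with * show "a = 0 \<and> b = 0" by simp
qed simp

text \<open>Provides the coordinate of \<open>x\<close> at \<open>1\<close>, so that
  \<open>1\<close>, \<open>z\<close> span \<open>F\<close> over \<open>L\<close> without a dimension
  count.\<close>

lemma bar_add_trace_z: "bar m (x + rel_trace m x * z) = x + rel_trace m x * (z :: 'a)"
  by (simp add: bar_simps trace_in_L) (simp add: rel_trace_def char_2_simps)

lemma norm_1_iff: "rel_norm m (X :: 'a) = 1 \<longleftrightarrow> (\<exists>x. x \<noteq> 0 \<and> X = x / bar m x)"
proof
  assume norm: "rel_norm m X = 1"
  show "\<exists>x. x \<noteq> 0 \<and> X = x / bar m x"
  proof (cases "X = 1")
    case True
    then show ?thesis
      by (intro exI[of _ 1]) (simp add: bar_simps)
  next
    case False
    then have "1 + X \<noteq> 0"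
      by (metis add_eq_0_iff_eq)
    moreover from this have "1 + bar m X \<noteq> 0"
      by (metis bar_eq_0_iff bar_add bar_1)
    moreover have "X * (1 + bar m X) = 1 + X"
      using norm by (simp add: rel_norm_def algebra_simps)
    \<comment> \<open>The Hilbert 90 witness \<open>1 + X\<close> is explicit; it vanishes only for
      \<open>X = 1\<close>, hence the case split.\<close>
    ultimately show ?thesis
      by (intro exI[of _ "1 + X"]) (simp add: bar_simps eq_divide_eq)
  qed
next
  assume "\<exists>x. x \<noteq> 0 \<and> X = x / bar m x"
  then show "rel_norm m X = 1"
    by (auto simp: rel_norm_def bar_simps)
qed

section \<open>The trace form, the presemifield and the norm polynomial\<close>

definition trace_form :: "nat \<Rightarrow> 'a \<Rightarrow> 'a \<Rightarrow> 'a \<Rightarrow> 'a" where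
  "trace_form s C1 C2 x = rel_trace m (C1 * x * bar m x ^ (2 ^ s) + C2 * x ^ (2 ^ s + 1))"

lemma trace_form_scale:
  assumes "bar m c = c"
  shows "trace_form s C1 C2 (c * x) = c ^ (2 ^ s + 1) * trace_form s C1 C2 x"
proof -
  have "C1 * (c * x) * bar m (c * x) ^ (2 ^ s) + C2 * (c * x) ^ (2 ^ s + 1)
      = c ^ (2 ^ s + 1) * (C1 * x * bar m x ^ (2 ^ s) + C2 * x ^ (2 ^ s + 1))"
    using assms by (simp add: bar_simps power_mult_distrib algebra_simps)
  with assms show ?thesis
    by (simp only: trace_form_def trace_scale bar_power)
qed

text \<open>The second coordinate of the product vanishes because \<open>x * bar m x\<close> and
  \<open>c\<close> lie in \<open>L\<close>; in the first, a power of \<open>c\<close> factors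
  out.\<close>

lemma star_scaled_bar:
  assumes "bar m c = c"
  shows "star m z s C1 C2 x (c * bar m x) = c ^ (2 ^ s) * trace_form s C1 C2 x"
proof -
  have "(C1 * (c * bar m x) ^ (2 ^ s) + C2 * bar m (c * bar m x) ^ (2 ^ s)) * x
      = c ^ (2 ^ s) * (C1 * x * bar m x ^ (2 ^ s) + C2 * x ^ (2 ^ s + 1))"
    using assms by (simp add: bar_simps power_mult_distrib algebra_simps)
  moreover have "rel_trace m (x * (c * bar m x)) = 0"
    using assms by (simp add: trace_eq_0_iff bar_simps algebra_simps)
  ultimately show ?thesis
    using assms by (simp only: star_def trace_form_def trace_scale bar_power) simp
qed

lemma star_eq_0_iff:
  "star m z s C1 C2 x y = 0 \<longleftrightarrow>
     rel_trace m ((C1 * y ^ (2 ^ s) + C2 * bar m y ^ (2 ^ s)) * x) = 0 \<and> rel_trace m (x * y) = 0"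
  unfolding star_def by (intro coords_eq_0_iff trace_in_L)

lemma star_add_right: "star m z s C1 C2 x (y + w) = star m z s C1 C2 x y + star m z s C1 C2 x w"
  by (simp add: star_def trace_add bar_simps add_power_2_power algebra_simps)

lemma star_add_left: "star m z s C1 C2 (x + y) w = star m z s C1 C2 x w + star m z s C1 C2 y w"
  by (simp add: star_def trace_add algebra_simps)

lemma presemifield_star_iff:
  "presemifield (star m z s C1 C2) \<longleftrightarrow> (\<forall>x. x \<noteq> 0 \<longrightarrow> trace_form s C1 C2 x \<noteq> 0)"
proof -
  have "trace_form s C1 C2 x \<noteq> 0"
    if "\<And>x y. star m z s C1 C2 x y = 0 \<Longrightarrow> x = 0 \<or> y = 0" and "x \<noteq> 0" for x
    using that(1)[of x "bar m x"] star_scaled_bar[of 1 s C1 C2 x] \<open>x \<noteq> 0\<close>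
    by (auto simp: bar_simps)
  moreover have "x = 0 \<or> y = 0"
    if nonzero: "\<And>x. x \<noteq> 0 \<Longrightarrow> trace_form s C1 C2 x \<noteq> 0" and star: "star m z s C1 C2 x y = 0" for x y
  proof (rule ccontr)
    assume "\<not> (x = 0 \<or> y = 0)"
    then have "x \<noteq> 0" "y \<noteq> 0" by auto
    define c where "c = y / bar m x"
    have y: "y = c * bar m x"
      using \<open>x \<noteq> 0\<close> by (simp add: c_def bar_eq_0_iff)
    have "bar m (x * y) = x * y"
      using star by (simp add: star_eq_0_iff trace_eq_0_iff)
    \<comment> \<open>As \<open>bar m c = bar m y / x\<close>, this is the previous equation divided
      by \<open>x * bar m x\<close>.\<close>
    then have "bar m c = c"
      using \<open>x \<noteq> 0\<close> by (simp add: c_def bar_simps frac_eq_eq mult.commute)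
    moreover have "c \<noteq> 0"
      using \<open>y \<noteq> 0\<close> y by auto
    ultimately show False
      using star nonzero[OF \<open>x \<noteq> 0\<close>] by (simp add: y star_scaled_bar)
  qed
  ultimately have "(\<forall>x y. star m z s C1 C2 x y = 0 \<longrightarrow> x = 0 \<or> y = 0) \<longleftrightarrow>
      (\<forall>x. x \<noteq> 0 \<longrightarrow> trace_form s C1 C2 x \<noteq> 0)"
    by metis
  then show ?thesis
    by (simp add: presemifield_def star_add_left star_add_right)
qed

text \<open>The two summands under the trace yield the terms with \<open>C1\<close> and
  \<open>C2\<close>, their conjugates those with \<open>bar m C1\<close> and
  \<open>bar m C2\<close>.\<close>

lemma trace_form_eq_norm_poly:
  assumes "x \<noteq> 0"
  shows "trace_form s C1 C2 x = bar m x ^ (2 ^ s + 1) * poly (norm_poly m s C1 C2) (x / bar m x)"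
proof -
  have "bar m x \<noteq> 0"
    using assms by (simp add: bar_eq_0_iff)
  then show ?thesis
    by (simp add: trace_form_def norm_poly_def rel_trace_def bar_simps poly_monom power_divide
        field_simps)
qed

lemma norm_poly_root_iff:
  "(\<exists>X. rel_norm m X = 1 \<and> poly (norm_poly m s C1 C2) X = 0) \<longleftrightarrow>
     (\<exists>x. x \<noteq> 0 \<and> trace_form s C1 C2 x = 0)"
proof -
  have "trace_form s C1 C2 x = 0 \<longleftrightarrow> poly (norm_poly m s C1 C2) (x / bar m x) = 0"
    if "x \<noteq> 0" for x
    using that by (simp add: trace_form_eq_norm_poly bar_eq_0_iff)
  then show ?thesis
    by (auto simp: norm_1_iff)
qed

lemma trace_form_zero_iff:
  "(\<exists>x. x \<noteq> 0 \<and> trace_form s C1 C2 x = 0) \<longleftrightarrow>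
     trace_form s C1 C2 1 = 0 \<or> (\<exists>a\<in>subfield_L m. trace_form s C1 C2 (a + z) = 0)"
proof
  assume "\<exists>x. x \<noteq> 0 \<and> trace_form s C1 C2 x = 0"
  then obtain x where x: "x \<noteq> 0" "trace_form s C1 C2 x = 0" by blast
  define b where "b = rel_trace m x"
  have b: "bar m b = b"
    by (simp add: b_def trace_in_L)
  show "trace_form s C1 C2 1 = 0 \<or> (\<exists>a\<in>subfield_L m. trace_form s C1 C2 (a + z) = 0)"
  proof (cases "b = 0")
    case True
    then have "bar m x = x"
      by (simp add: b_def trace_eq_0_iff)
    then show ?thesis
      using trace_form_scale[of x s C1 C2 1] x by simp
  next
    case False
    \<comment> \<open>The quotient of the two coordinates of \<open>x\<close>, that is, its affine
      coordinate on the projective line.\<close>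
    define a where "a = (x + b * z) / b"
    have "bar m a = a"
      using bar_add_trace_z[of x] b by (simp add: a_def b_def bar_divide)
    moreover have "b * a = x + b * z"
      using False by (simp add: a_def)
    then have "x = b * (a + z)"
      by (simp add: distrib_left add.assoc add_self)
    then have "trace_form s C1 C2 (a + z) = 0"
      using x False trace_form_scale[OF b] by simp
    ultimately show ?thesis
      by (auto simp: in_L_iff)
  qed
next
  have "a + z \<noteq> 0" if "a \<in> subfield_L m" for a
    using coords_eq_0_iff[of a 1] that by (simp add: in_L_iff bar_1)
  then show "\<exists>x. x \<noteq> 0 \<and> trace_form s C1 C2 x = 0"
    if "trace_form s C1 C2 1 = 0 \<or> (\<exists>a\<in>subfield_L m. trace_form s C1 C2 (a + z) = 0)"
    using that zero_neq_one by metis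
qed

section \<open>The quadruple as coefficients of the trace form\<close>

lemma bar_mu: "bar m \<mu> = \<mu>"
  by (simp add: bar_simps char_2_simps power2_eq_square flip: z_root)

text \<open>Reduce \<open>z ^ 2\<close> to \<open>\<mu> + z\<close> and read off the
  \<open>z\<close>-coordinate of the product.\<close>

lemma trace_mult_coords:
  assumes "bar m v = v" "bar m h = h" "bar m e = e" "bar m f = f"
  shows "rel_trace m ((v + h * z) * (e + f * z)) = v * f + h * e + h * f"
proof -
  have "(v + h * z) * (e + f * z) = (v * e + h * f * z ^ 2) + (v * f + h * e) * z"
    by (simp add: algebra_simps power2_eq_square)
  also have "z ^ 2 = \<mu> + z"
    using z_root by (metis add_self_left add.commute)
  also have "(v * e + h * f * (\<mu> + z)) + (v * f + h * e) * z
      = (v * e + h * f * \<mu>) + (v * f + h * e + h * f) * z"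
    by (simp add: algebra_simps)
  finally show ?thesis
    using assms bar_mu by (simp add: trace_coords bar_simps)
qed

text \<open>Conjugation adds 1 to both \<open>z\<close> and \<open>z ^ (2 ^ n)\<close>, so it fixes
  their sum.\<close>

lemma bar_mu_sum: "bar m (mu_sum \<mu> n) = mu_sum \<mu> n"
proof -
  have "mu_sum \<mu> n = z + z ^ (2 ^ n)"
    by (simp add: z_power_2_power add_self_left)
  then show ?thesis
    by (simp add: bar_simps add_power_2_power char_2_simps)
qed

lemma trace_form_1:
  assumes "bar m v1 = v1" "bar m h1 = h1" "bar m v2 = v2" "bar m h2 = h2"
  shows "trace_form s (v1 + h1 * z) (v2 + h2 * z) 1 = h1 + h2"
  using assms by (simp add: trace_form_def trace_add[of "v1 + h1 * z"] trace_coords bar_1)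

lemma trace_form_a_plus_z:
  assumes L: "bar m v1 = v1" "bar m h1 = h1" "bar m v2 = v2" "bar m h2 = h2" "bar m a = a"
  shows "trace_form s (v1 + h1 * z) (v2 + h2 * z) (a + z) =
    poly (quad_poly s (quadruple \<mu> s (v1, h1) (v2, h2))) a"
proof -
  let ?A = "a ^ (2 ^ s)" and ?M = "mu_sum \<mu> s"
  have A: "bar m ?A = ?A"
    using L by (simp add: bar_power)
  have z2: "z * z = z + \<mu>"
    using z_root by (metis add_self_left add.commute power2_eq_square)
  have pow: "(a + z) ^ (2 ^ s) = ?A + (z + ?M)"
    by (simp add: add_power_2_power z_power_2_power)
  \<comment> \<open>Conjugation only adds 1 to \<open>a + z\<close>, and so also to its
    power.\<close>
  have "bar m (a + z) ^ (2 ^ s) = ?A + (z + ?M) + 1"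
    using L by (simp add: bar_simps add_power_2_power z_power_2_power)
  then have "(a + z) * bar m (a + z) ^ (2 ^ s) = (a + z) * (?A + z + ?M + 1)"
    by (simp add: add.assoc)
  also have "\<dots> = (a * ?A + a * ?M + a + \<mu>) + (a + ?A + ?M) * z"
    by (simp add: char_2_simps z2)
  finally have 1: "(v1 + h1 * z) * (a + z) * bar m (a + z) ^ (2 ^ s)
      = (v1 + h1 * z) * ((a * ?A + a * ?M + a + \<mu>) + (a + ?A + ?M) * z)"
    by (simp add: mult.assoc)
  have "(a + z) ^ (2 ^ s + 1) = (a + z) * (?A + (z + ?M))"
    by (simp add: pow)
  also have "\<dots> = (a * ?A + a * ?M + \<mu>) + (a + ?A + ?M + 1) * z"
    by (simp add: char_2_simps z2)
  finally have 2: "(v2 + h2 * z) * (a + z) ^ (2 ^ s + 1)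
      = (v2 + h2 * z) * ((a * ?A + a * ?M + \<mu>) + (a + ?A + ?M + 1) * z)"
    by simp
  \<comment> \<open>Both factors are now in coordinates over \<open>L\<close>. Collecting the
    coefficients of \<open>a * ?A\<close>, \<open>?A\<close>, \<open>a\<close> and 1 then gives the
    four entries of the quadruple.\<close>
  have "trace_form s (v1 + h1 * z) (v2 + h2 * z) (a + z) =
    v1 * (a + ?A + ?M) + h1 * (a * ?A + a * ?M + a + \<mu>) + h1 * (a + ?A + ?M)
    + (v2 * (a + ?A + ?M + 1) + h2 * (a * ?A + a * ?M + \<mu>) + h2 * (a + ?A + ?M + 1))"
    unfolding trace_form_def 1 2 trace_add
    by (intro arg_cong2[where f = "(+)"] trace_mult_coords)
      (simp_all add: L A bar_add bar_mult bar_1 bar_mu bar_mu_sum)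
  also have "\<dots> = poly (quad_poly s (quadruple \<mu> s (v1, h1) (v2, h2))) a"
    by (simp add: quad_poly_def quadruple_def poly_monom char_2_simps)
  finally show ?thesis .
qed

end

theorem theorem2:
  fixes m s :: nat
    and \<mu> z C1 C2 v1 h1 v2 h2 p1 p2 p3 p4 :: "'a::{field,finite}"
  assumes "m \<ge> 1"
    and "card (UNIV :: 'a set) = 2 ^ (2 * m)"
    and "\<mu> \<in> subfield_L m"
    and "abs_trace m \<mu> = 1"
    and "z ^ 2 + z = \<mu>"
    and "s < 2 * m"
    and "v1 \<in> subfield_L m" and "h1 \<in> subfield_L m"
    and "v2 \<in> subfield_L m" and "h2 \<in> subfield_L m"
    and "C1 = elem_of_coords z (v1, h1)"
    and "C2 = elem_of_coords z (v2, h2)"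
    and "(p1, p2, p3, p4) = quadruple \<mu> s (v1, h1) (v2, h2)"
  shows "(presemifield (star m z s C1 C2) \<longleftrightarrow>
            (\<forall>x. x \<noteq> 0 \<longrightarrow>
               rel_trace m (C1 * x * (bar m x) ^ (2 ^ s) + C2 * x ^ (2 ^ s + 1)) \<noteq> 0))
       \<and> ((\<forall>x. x \<noteq> 0 \<longrightarrow>
               rel_trace m (C1 * x * (bar m x) ^ (2 ^ s) + C2 * x ^ (2 ^ s + 1)) \<noteq> 0) \<longleftrightarrow>
            \<not> (\<exists>X. rel_norm m X = 1 \<and> poly (norm_poly m s C1 C2) X = 0))
       \<and> (\<not> (\<exists>X. rel_norm m X = 1 \<and> poly (norm_poly m s C1 C2) X = 0) \<longleftrightarrow>
            p1 \<noteq> 0 \<and> \<not> (\<exists>X \<in> subfield_L m. poly (quad_poly s (p1, p2, p3, p4)) X = 0))"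
proof -
  interpret quadratic_gf m \<mu> z
    using assms by unfold_locales
  have L: "bar m v1 = v1" "bar m h1 = h1" "bar m v2 = v2" "bar m h2 = h2"
    using assms by (simp_all add: in_L_iff)
  have C: "C1 = v1 + h1 * z" "C2 = v2 + h2 * z"
    using assms by (simp_all add: elem_of_coords_def)
  \<comment> \<open>The point represented by \<open>1\<close> is the point at infinity, which is a
    root exactly if \<open>p1 = 0\<close>.\<close>
  have "p1 = trace_form s C1 C2 1"
    using assms(13) by (simp add: C L trace_form_1 quadruple_def)
  moreover have "poly (quad_poly s (p1, p2, p3, p4)) a = trace_form s C1 C2 (a + z)"
    if "a \<in> subfield_L m" for a
    using that by (simp only: C L trace_form_a_plus_z in_L_iff assms(13))
  ultimately have "(\<exists>x. x \<noteq> 0 \<and> trace_form s C1 C2 x = 0) \<longleftrightarrow>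
      p1 = 0 \<or> (\<exists>X\<in>subfield_L m. poly (quad_poly s (p1, p2, p3, p4)) X = 0)"
    by (simp add: trace_form_zero_iff)
  then show ?thesis
    unfolding trace_form_def[symmetric] presemifield_star_iff norm_poly_root_iff by blast
qed

end
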